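(* The set of binary delta-matroids is closed under handle slides: if $D=(E,\mathcal{F})$ is a binary delta-matroid and $a,b\in E$ are distinct, then $D_{ab}$ is a binary delta-matroid.
   Context: A delta-matroid is a set system $(E,\mathcal{F})$ ($E$ finite, $\mathcal{F}$ a non-empty collection of subsets of $E$) such that for all $X,Y\in\mathcal{F}$ and $u\in X\triangle Y$ there is $v\in X\triangle Y$ with $X\triangle\{u,v\}\in\mathcal{F}$. For a symmetric matrix $M$ over $GF(2)$ indexed by $E$, $D(M)$ has feasible sets the $A\subseteq E$ with $M[A]$ non-singular ($M[\emptyset]$ non-singular by convention). Twist: $D*A=(E,\{A\triangle X:X\in\mathcal{F}\})$. $D$ is binary if some twist of it is isomorphic to $D(M)$ for some symmetric matrix $M$ over $GF(2)$. Handle slide of $a$ over $b$: $D_{ab}=(E,\mathcal{F}\triangle\{X\cup\{a\}: X\cup\{b\}\in\mathcal{F},\ X\subseteq E\setminus\{a,b\}\})$. *)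

theory Defs
  imports
    "HOL-Library.Z2"
    "Jordan_Normal_Form.Determinant"
    "Jordan_Normal_Form.DL_Submatrix"
begin

(* A set system is a pair: the ground set and the collection of feasible sets. *)
type_synonym 'a set_system = "'a set \<times> 'a set set"

(* The elements u and v in the exchange axiom may coincide. *)
definition delta_matroid :: "'a set_system \<Rightarrow> bool" where
  "delta_matroid D \<longleftrightarrow>
    (case D of (E, F) \<Rightarrow>
      finite E \<and> F \<subseteq> Pow E \<and> F \<noteq> {} \<and>
      (\<forall>X\<in>F. \<forall>Y\<in>F. \<forall>u\<in>sym_diff X Y. \<exists>v\<in>sym_diff X Y. sym_diff X {u, v} \<in> F))"

definition twist :: "'a set_system \<Rightarrow> 'a set \<Rightarrow> 'a set_system" where
  "twist D A = (fst D, {sym_diff A X | X. X \<in> snd D})"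

definition isomorphic :: "'a set_system \<Rightarrow> 'b set_system \<Rightarrow> bool" where
  "isomorphic D D' \<longleftrightarrow>
    (\<exists>f. bij_betw f (fst D) (fst D') \<and>
         (\<forall>X. X \<subseteq> fst D \<longrightarrow> (X \<in> snd D \<longleftrightarrow> f ` X \<in> snd D')))"

(* The set system D(M), with the rows and columns of M indexed by {0..<n}.  For A = {} the
   submatrix has size 0 x 0 and determinant 1, which is the convention that M[{}] is
   non-singular; see empty_feasible below. *)
definition matrix_system :: "'k::field mat \<Rightarrow> nat set_system" where
  "matrix_system M =
    ({0..<dim_row M}, {A. A \<subseteq> {0..<dim_row M} \<and> det (submatrix M A A) \<noteq> 0})"

lemma empty_feasible: "{} \<in> snd (matrix_system M)"
  by (simp add: matrix_system_def submatrix_def)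

(* GF(2) is the field bit.  A matrix indexed by an arbitrary n-element set is, up to relabelling,
   an n x n matrix indexed by {0..<n}; the relabelling is part of the isomorphism. *)
definition binary_delta_matroid :: "'a set_system \<Rightarrow> bool" where
  "binary_delta_matroid D \<longleftrightarrow>
    delta_matroid D \<and>
    (\<exists>A n. \<exists>M :: bit mat.
      A \<subseteq> fst D \<and> M \<in> carrier_mat n n \<and> transpose_mat M = M \<and>
      isomorphic (twist D A) (matrix_system M))"

(* The handle slide of a over b. *)
definition handle_slide :: "'a set_system \<Rightarrow> 'a \<Rightarrow> 'a \<Rightarrow> 'a set_system" where
  "handle_slide D a b =
    (case D of (E, F) \<Rightarrow>
      (E, sym_diff F {X \<union> {a} | X. X \<subseteq> E - {a, b} \<and> X \<union> {b} \<in> F}))"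

end

theory Submission
  imports Defs
begin

text \<open>
  A set system on \<open>E\<close> is represented by two matrices \<open>p\<close>, \<open>q\<close> over \<open>GF(2)\<close> whose joint column
  space is isotropic for the standard symplectic form: a set \<open>X\<close> is feasible if and only if
  the matrix with rows \<open>q i\<close> for \<open>i \<in> X\<close> and \<open>p i\<close> for \<open>i \<notin> X\<close> is non-singular.
  For a twist of \<open>D(M)\<close> by \<open>A\<close> one takes \<open>p\<close> to be the identity and \<open>q = M\<close>, with the rows in
  \<open>A\<close> exchanged. Conversely, multiplying \<open>p\<close> and \<open>q\<close> on the right by the inverse of the matrix of a feasible
  set \<open>B\<close> brings the pair into this form with \<open>A = B\<close>; isotropy makes the resulting \<open>M\<close> symmetric.

  The handle slide of \<open>a\<close> over \<open>b\<close> is the symplectic row operation that adds row \<open>b\<close> to row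
  \<open>a\<close> in \<open>q\<close> and row \<open>a\<close> to row \<open>b\<close> in \<open>p\<close>. Only for \<open>a \<in> X\<close>, \<open>b \<notin> X\<close> does this affect
  singularity. There the determinant expands into four terms: two are the determinants of \<open>X\<close>
  and of \<open>X - a + b\<close>, and the other two cancel by isotropy.
\<close>

text \<open>These rules rewrite sums and products of bits to bit operations, out of reach of the ring rules.\<close>

declare add_bit_eq_xor [simp del] mult_bit_eq_and [simp del]

lemma bit_add_self [simp]: "x + x = (0::bit)"
  by (cases x) simp_all

lemma bit_add_eq_0_iff: "x + y = 0 \<longleftrightarrow> x = (y::bit)"
  by (cases x; cases y) simp_all

section \<open>Linear algebra with rows and columns indexed by a finite set\<close>

definition mat_vec :: "'a set \<Rightarrow> ('a \<Rightarrow> 'a \<Rightarrow> 'k::comm_ring_1) \<Rightarrow> ('a \<Rightarrow> 'k) \<Rightarrow> 'a \<Rightarrow> 'k" where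
  "mat_vec E g x i = (\<Sum>j\<in>E. g i j * x j)"

text \<open>Trivial kernel replaces non-zero determinant, so the index set needs no order. For the
  empty index set the condition holds vacuously, which agrees with the convention on
  \<open>M[{}]\<close>.\<close>

definition nonsingular_on :: "('a \<Rightarrow> 'a \<Rightarrow> 'k::comm_ring_1) \<Rightarrow> 'a set \<Rightarrow> bool" where
  "nonsingular_on g E \<longleftrightarrow> (\<forall>x. (\<forall>i\<in>E. mat_vec E g x i = 0) \<longrightarrow> (\<forall>i\<in>E. x i = 0))"

lemma mat_vec_cong:
  "(\<And>j. j \<in> E \<Longrightarrow> g i j = g' i j) \<Longrightarrow> (\<And>j. j \<in> E \<Longrightarrow> x j = y j) \<Longrightarrow> mat_vec E g x i = mat_vec E g' y i"
  by (simp add: mat_vec_def)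

lemma mat_vec_add: "mat_vec E g (\<lambda>j. x j + y j) i = mat_vec E g x i + mat_vec E g y i"
  by (simp add: mat_vec_def distrib_left sum.distrib)

lemma mat_vec_scale: "mat_vec E g (\<lambda>j. c * x j) i = c * mat_vec E g x i"
  by (simp add: mat_vec_def sum_distrib_left ac_simps)

text \<open>The matrix on the left is the product of \<open>g\<close> and \<open>h\<close>: its
  column \<open>k\<close> is \<open>g\<close> applied to column \<open>k\<close> of
  \<open>h\<close>.\<close>

lemma mat_vec_mult:
  "mat_vec E (\<lambda>i k. mat_vec E g (\<lambda>j. h j k) i) x i = mat_vec E g (mat_vec E h x) i"
proof -
  have "mat_vec E (\<lambda>i k. mat_vec E g (\<lambda>j. h j k) i) x i = (\<Sum>k\<in>E. \<Sum>j\<in>E. g i j * h j k * x k)"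
    by (simp add: mat_vec_def sum_distrib_right)
  also have "\<dots> = (\<Sum>j\<in>E. \<Sum>k\<in>E. g i j * h j k * x k)"
    by (rule sum.swap)
  also have "\<dots> = mat_vec E g (mat_vec E h x) i"
    by (simp add: mat_vec_def sum_distrib_left ac_simps)
  finally show ?thesis .
qed

lemma mat_vec_unit:
  assumes "finite E" "k \<in> E"
  shows "mat_vec E g (\<lambda>j. if j = k then 1 else 0) i = g i k"
  using assms by (simp add: mat_vec_def if_distrib cong: if_cong)

lemma mat_vec_subset:
  assumes "finite E" "S \<subseteq> E" "\<And>j. j \<in> E - S \<Longrightarrow> x j = 0"
  shows "mat_vec E g x i = mat_vec S g x i"
  unfolding mat_vec_def using assms by (intro sum.mono_neutral_right) auto

text \<open>Kernel vectors are carried along \<open>f\<close> in both directions by reindexing the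
  sums. This serves two relabellings: the one inside \<open>submatrix\<close> and the one in
  \<open>isomorphic\<close>.\<close>

lemma nonsingular_on_image:
  assumes f: "inj_on f S" and g: "\<And>i j. i \<in> S \<Longrightarrow> j \<in> S \<Longrightarrow> g' (f i) (f j) = g i j"
  shows "nonsingular_on g' (f ` S) \<longleftrightarrow> nonsingular_on g S"
proof -
  have mv: "mat_vec (f ` S) g' x (f i) = mat_vec S g (x \<circ> f) i" if "i \<in> S" for x i
    using that by (simp add: mat_vec_def sum.reindex[OF f] g)
  show ?thesis
  proof
    assume ns: "nonsingular_on g' (f ` S)"
    show "nonsingular_on g S"
      unfolding nonsingular_on_def
    proof (intro allI impI ballI)
      fix x i assume x: "\<forall>i\<in>S. mat_vec S g x i = 0" and i: "i \<in> S"
      have "mat_vec S g ((x \<circ> inv_into S f) \<circ> f) j = mat_vec S g x j" for j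
        using f by (intro mat_vec_cong) simp_all
      then have "\<forall>j\<in>f ` S. mat_vec (f ` S) g' (x \<circ> inv_into S f) j = 0"
        using x mv by auto
      then have "(x \<circ> inv_into S f) (f i) = 0"
        using ns i unfolding nonsingular_on_def by blast
      then show "x i = 0" using f i by simp
    qed
  next
    assume ns: "nonsingular_on g S"
    show "nonsingular_on g' (f ` S)"
      unfolding nonsingular_on_def
    proof (intro allI impI)
      fix x assume "\<forall>i\<in>f ` S. mat_vec (f ` S) g' x i = 0"
      then have "\<forall>i\<in>S. mat_vec S g (x \<circ> f) i = 0" using mv by auto
      then have "\<forall>i\<in>S. (x \<circ> f) i = 0" using ns unfolding nonsingular_on_def by blast
      then show "\<forall>i\<in>f ` S. x i = 0" by simp
    qed
  qed
qed

section \<open>Comparison with determinants of submatrices\<close>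

lemma det_neq_0_iff_nonsingular_on:
  fixes N :: "'k::field mat"
  assumes N: "N \<in> carrier_mat k k"
  shows "det N \<noteq> 0 \<longleftrightarrow> nonsingular_on (\<lambda>i j. N $$ (i, j)) {0..<k}"
proof -
  have mv: "(N *\<^sub>v v) $ i = mat_vec {0..<k} (\<lambda>i j. N $$ (i, j)) (\<lambda>j. v $ j) i"
    if "v \<in> carrier_vec k" "i < k" for v i
    using N that by (auto simp: mat_vec_def scalar_prod_def intro!: sum.cong)
  show ?thesis
  proof
    assume det: "det N \<noteq> 0"
    show "nonsingular_on (\<lambda>i j. N $$ (i, j)) {0..<k}"
      unfolding nonsingular_on_def
    proof (intro allI impI ballI)
      fix x i
      assume x: "\<forall>i\<in>{0..<k}. mat_vec {0..<k} (\<lambda>i j. N $$ (i, j)) x i = 0" and i: "i \<in> {0..<k}"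
      have "mat_vec {0..<k} (\<lambda>i j. N $$ (i, j)) (\<lambda>j. vec k x $ j) l
          = mat_vec {0..<k} (\<lambda>i j. N $$ (i, j)) x l" for l
        by (intro mat_vec_cong) simp_all
      then have "N *\<^sub>v vec k x = 0\<^sub>v k"
        using N x mv[of "vec k x"] by (intro eq_vecI) auto
      then have "vec k x = 0\<^sub>v k"
        using det det_0_iff_vec_prod_zero[OF N] vec_carrier by metis
      then have "vec k x $ i = 0\<^sub>v k $ i" by simp
      then show "x i = 0" using i by simp
    qed
  next
    assume ns: "nonsingular_on (\<lambda>i j. N $$ (i, j)) {0..<k}"
    have "v = 0\<^sub>v k" if v: "v \<in> carrier_vec k" "N *\<^sub>v v = 0\<^sub>v k" for v
    proof -
      have "\<forall>i\<in>{0..<k}. mat_vec {0..<k} (\<lambda>i j. N $$ (i, j)) (\<lambda>j. v $ j) i = 0"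
        using mv[OF v(1)] v(2) by (metis atLeastLessThan_iff index_zero_vec(1))
      then have "\<forall>i\<in>{0..<k}. v $ i = 0"
        using ns unfolding nonsingular_on_def by blast
      then show ?thesis using v by (intro eq_vecI) auto
    qed
    then show "det N \<noteq> 0" using det_0_iff_vec_prod_zero[OF N] by auto
  qed
qed

text \<open>\<open>submatrix\<close> renumbers the indices in \<open>C\<close> by
  \<open>pick C\<close>, a bijection from \<open>{0..<card C}\<close> onto \<open>C\<close>, so this
  is an instance of relabelling.\<close>

lemma det_submatrix_neq_0_iff:
  fixes M :: "'k::field mat"
  assumes M: "M \<in> carrier_mat n n" and C: "C \<subseteq> {0..<n}"
  shows "det (submatrix M C C) \<noteq> 0 \<longleftrightarrow> nonsingular_on (\<lambda>i j. M $$ (i, j)) C"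
proof -
  have fin: "finite C" using C finite_subset by blast
  have Cn: "{i. i < n \<and> i \<in> C} = C" using C by auto
  have sub: "submatrix M C C \<in> carrier_mat (card C) (card C)"
    using M by (auto simp: submatrix_def Cn)
  have pick: "pick C i \<in> C" if "i < card C" for i
    using that by (rule pick_in_set_le)
  have inj: "inj_on (pick C) {0..<card C}"
    by (rule inj_onI) (metis atLeastLessThan_iff linorder_neqE_nat nat_less_le pick_mono_le)
  have img: "pick C ` {0..<card C} = C"
    by (rule card_subset_eq[OF fin]) (use pick in \<open>auto simp: card_image[OF inj]\<close>)
  have "nonsingular_on (\<lambda>i j. M $$ (i, j)) (pick C ` {0..<card C})
      \<longleftrightarrow> nonsingular_on (\<lambda>i j. submatrix M C C $$ (i, j)) {0..<card C}"
    using M by (intro nonsingular_on_image[OF inj]) (simp add: submatrix_def Cn)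
  then show ?thesis
    using det_neq_0_iff_nonsingular_on[OF sub] by (simp add: img)
qed

section \<open>Solvability and inverses over GF(2)\<close>

text \<open>There are only finitely many vectors over GF(2), so an injective map of the vector space
  to itself is surjective; no dimension theory is involved.\<close>

lemma nonsingular_on_surj:
  fixes g :: "'a \<Rightarrow> 'a \<Rightarrow> bit"
  assumes E: "finite E" and ns: "nonsingular_on g E"
  obtains x where "\<And>i. i \<in> E \<Longrightarrow> mat_vec E g x i = t i"
proof -
  \<comment> \<open>Extensional functions make a vector determined by its values on
    \<open>E\<close>, so \<open>V\<close> is finite and injectivity is an equality of
    functions.\<close>
  define V where "V = E \<rightarrow>\<^sub>E (UNIV :: bit set)"
  define G where "G x = restrict (mat_vec E g x) E" for x
  have "finite (UNIV :: bit set)"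
    by (rule finite_subset[of _ "{0, 1}"]) (auto intro: bit.exhaust)
  then have V: "finite V" unfolding V_def using E by (simp add: finite_PiE)
  have "inj_on G V"
  proof (rule inj_onI)
    fix x y assume xy: "x \<in> V" "y \<in> V" and eq: "G x = G y"
    have "mat_vec E g (\<lambda>j. x j + y j) i = 0" if "i \<in> E" for i
      using fun_cong[OF eq, of i] that by (simp add: G_def mat_vec_add)
    then have "\<forall>i\<in>E. x i + y i = 0"
      using ns unfolding nonsingular_on_def by blast
    then show "x = y"
      using xy by (auto simp: V_def bit_add_eq_0_iff intro: PiE_ext)
  qed
  moreover have "G ` V \<subseteq> V" by (auto simp: G_def V_def)
  ultimately have "G ` V = V" using V by (simp add: endo_inj_surj)
  moreover have "restrict t E \<in> V" by (simp add: V_def)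
  ultimately obtain x where "G x = restrict t E" by (metis imageE)
  then have "mat_vec E g x i = t i" if "i \<in> E" for i
    using that by (metis G_def restrict_apply')
  then show ?thesis by (rule that)
qed

text \<open>The columns of \<open>h\<close> solve the systems with unit vectors on the right, which
  gives a right inverse. It is also a left inverse, because \<open>g\<close> maps both
  \<open>h (g x)\<close> and \<open>x\<close> to \<open>g x\<close> and has trivial kernel.\<close>

lemma nonsingular_on_inverse:
  fixes g :: "'a \<Rightarrow> 'a \<Rightarrow> bit"
  assumes E: "finite E" and ns: "nonsingular_on g E"
  obtains h where "\<And>i x. i \<in> E \<Longrightarrow> mat_vec E g (mat_vec E h x) i = x i"
    and "\<And>i x. i \<in> E \<Longrightarrow> mat_vec E h (mat_vec E g x) i = x i"
proof -
  have "\<exists>x. \<forall>i\<in>E. mat_vec E g x i = (if i = k then 1 else 0)" for k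
    by (rule nonsingular_on_surj[OF E ns, of "\<lambda>i. if i = k then 1 else 0"]) blast
  then obtain c where c: "\<And>k i. i \<in> E \<Longrightarrow> mat_vec E g (c k) i = (if i = k then 1 else 0)"
    by metis
  define h where "h j k = c k j" for j k
  have r: "mat_vec E g (mat_vec E h x) i = x i" if i: "i \<in> E" for i x
  proof -
    have "mat_vec E g (mat_vec E h x) i = (\<Sum>k\<in>E. (if i = k then 1 else 0) * x k)"
      unfolding mat_vec_mult[symmetric] h_def
      by (simp add: mat_vec_def[of E "\<lambda>i k. mat_vec E g (c k) i"] c[OF i])
    also have "\<dots> = (\<Sum>k\<in>E. if i = k then x k else 0)"
      by (rule sum.cong) auto
    also have "\<dots> = x i" using i E by simp
    finally show ?thesis .
  qed
  have l: "mat_vec E h (mat_vec E g x) i = x i" if "i \<in> E" for i x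
  proof -
    have "\<forall>i\<in>E. mat_vec E g (\<lambda>j. mat_vec E h (mat_vec E g x) j + x j) i = 0"
      by (simp add: mat_vec_add r)
    then have "mat_vec E h (mat_vec E g x) i + x i = 0"
      using ns that unfolding nonsingular_on_def by blast
    then show ?thesis by (simp add: bit_add_eq_0_iff)
  qed
  show ?thesis using that[of h] r l by blast
qed

section \<open>Isotropic pairs and pivoting\<close>

text \<open>The sum is the standard symplectic form of the vectors \<open>(p x, q x)\<close> and
  \<open>(p y, q y)\<close>; over GF(2) its minus sign becomes a plus.\<close>

definition isotropic :: "'a set \<Rightarrow> ('a \<Rightarrow> 'a \<Rightarrow> bit) \<Rightarrow> ('a \<Rightarrow> 'a \<Rightarrow> bit) \<Rightarrow> bool" where
  "isotropic E p q \<longleftrightarrow>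
    (\<forall>x y. (\<Sum>i\<in>E. mat_vec E p x i * mat_vec E q y i + mat_vec E q x i * mat_vec E p y i) = 0)"

definition choose_rows :: "('a \<Rightarrow> 'a \<Rightarrow> 'k) \<Rightarrow> ('a \<Rightarrow> 'a \<Rightarrow> 'k) \<Rightarrow> 'a set \<Rightarrow> 'a \<Rightarrow> 'a \<Rightarrow> 'k" where
  "choose_rows p q X i = (if i \<in> X then q i else p i)"

lemma mat_vec_choose_rows:
  "mat_vec E (choose_rows p q X) x i = (if i \<in> X then mat_vec E q x i else mat_vec E p x i)"
  by (simp add: mat_vec_def choose_rows_def)

text \<open>In the coordinates \<open>y = g x\<close>, where \<open>g\<close> consists of the rows
  chosen by \<open>B\<close>, those rows become unit rows and the rows left out become the rows of
  \<open>m\<close>. The choice \<open>X\<close> then has unit rows outside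
  \<open>sym_diff X B\<close>, which force \<open>y\<close> to vanish there and leave a principal
  submatrix of \<open>m\<close>.\<close>

lemma nonsingular_on_pivot:
  fixes p q :: "'a \<Rightarrow> 'a \<Rightarrow> bit"
  assumes E: "finite E" and B: "nonsingular_on (choose_rows p q B) E"
    and m: "\<And>x i. i \<in> E \<Longrightarrow>
      mat_vec E m (mat_vec E (choose_rows p q B) x) i = mat_vec E (choose_rows q p B) x i"
  shows "nonsingular_on (choose_rows p q X) E \<longleftrightarrow> nonsingular_on m (E \<inter> sym_diff X B)"
proof -
  define g where "g = choose_rows p q B"
  define g' where "g' = choose_rows q p B"
  obtain h where gh: "\<And>i x. i \<in> E \<Longrightarrow> mat_vec E g (mat_vec E h x) i = x i"
    and "\<And>i x. i \<in> E \<Longrightarrow> mat_vec E h (mat_vec E g x) i = x i"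
    by (fact nonsingular_on_inverse[OF E B, folded g_def])
  have mg: "mat_vec E m (mat_vec E g x) i = mat_vec E g' x i" if "i \<in> E" for x i
    using m[OF that] unfolding g_def g'_def .
  have mh: "mat_vec E g' (mat_vec E h y) i = mat_vec E m y i" if "i \<in> E" for y i
    unfolding mg[OF that, symmetric] by (rule mat_vec_cong) (simp_all add: gh)
  let ?S = "E \<inter> sym_diff X B"
  have rows: "mat_vec E (choose_rows p q X) x i
      = (if i \<in> sym_diff X B then mat_vec E g' x i else mat_vec E g x i)" for x i
    by (auto simp: g_def g'_def mat_vec_choose_rows)
  have S: "?S \<subseteq> E" by blast
  show ?thesis
  proof
    assume ns: "nonsingular_on (choose_rows p q X) E"
    show "nonsingular_on m ?S"
      unfolding nonsingular_on_def
    proof (intro allI impI ballI)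
      fix y i assume y: "\<forall>i\<in>?S. mat_vec ?S m y i = 0" and i: "i \<in> ?S"
      \<comment> \<open>A kernel vector of the principal submatrix is extended by zero and pulled
        back along \<open>h\<close> to a kernel vector of the rows chosen by
        \<open>X\<close>.\<close>
      define z where "z j = (if j \<in> ?S then y j else 0)" for j
      have mz: "mat_vec E m z j = 0" if "j \<in> ?S" for j
      proof -
        have "mat_vec E m z j = mat_vec ?S m z j"
          by (rule mat_vec_subset[OF E S]) (auto simp: z_def)
        also have "\<dots> = mat_vec ?S m y j" by (rule mat_vec_cong) (auto simp: z_def)
        finally show ?thesis using y that by simp
      qed
      have "mat_vec E (choose_rows p q X) (mat_vec E h z) j = 0" if "j \<in> E" for j
        using mz[of j] that by (simp add: rows gh mh) (simp add: z_def)
      then have "\<forall>j\<in>E. mat_vec E (choose_rows p q X) (mat_vec E h z) j = 0" by blast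
      then have "\<forall>j\<in>E. mat_vec E h z j = 0"
        using ns unfolding nonsingular_on_def by blast
      then have "mat_vec E g (mat_vec E h z) i = 0"
        by (simp add: mat_vec_def[of E g])
      then show "y i = 0" using i gh[of i z] by (simp add: z_def)
    qed
  next
    assume ns: "nonsingular_on m ?S"
    show "nonsingular_on (choose_rows p q X) E"
      unfolding nonsingular_on_def
    proof (intro allI impI)
      fix x assume x: "\<forall>i\<in>E. mat_vec E (choose_rows p q X) x i = 0"
      let ?y = "mat_vec E g x"
      have off: "?y j = 0" if "j \<in> E - ?S" for j
        using that x rows[of x j] by (metis DiffD1 DiffD2 IntI)
      have "mat_vec ?S m ?y j = 0" if "j \<in> ?S" for j
      proof -
        have "mat_vec ?S m ?y j = mat_vec E m ?y j"
          by (rule mat_vec_subset[OF E S, symmetric]) (rule off)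
        also have "\<dots> = mat_vec E g' x j" using that by (simp add: mg)
        also have "\<dots> = 0" using that x rows[of x j] by (metis IntD1 IntD2)
        finally show ?thesis .
      qed
      then have "\<forall>j\<in>?S. ?y j = 0" using ns unfolding nonsingular_on_def by blast
      then have "\<forall>j\<in>E. mat_vec E (choose_rows p q B) x j = 0"
        using off unfolding g_def by blast
      then show "\<forall>i\<in>E. x i = 0" using B unfolding nonsingular_on_def by blast
    qed
  qed
qed

text \<open>Here \<open>m\<close> is the product of \<open>g'\<close> with the inverse of
  \<open>g\<close>. Isotropy of the pair is symmetry of \<open>m\<close>, as evaluating the form on
  two columns of the inverse shows.\<close>

lemma isotropic_rebase:
  assumes E: "finite E" and iso: "isotropic E p q" and B: "nonsingular_on (choose_rows p q B) E"
  obtains m :: "'a \<Rightarrow> 'a \<Rightarrow> bit" where "\<And>i j. i \<in> E \<Longrightarrow> j \<in> E \<Longrightarrow> m i j = m j i"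
    and "\<And>X. nonsingular_on (choose_rows p q X) E \<longleftrightarrow> nonsingular_on m (E \<inter> sym_diff X B)"
proof -
  define g where "g = choose_rows p q B"
  define g' where "g' = choose_rows q p B"
  obtain h where gh: "\<And>i x. i \<in> E \<Longrightarrow> mat_vec E g (mat_vec E h x) i = x i"
    and hg: "\<And>i x. i \<in> E \<Longrightarrow> mat_vec E h (mat_vec E g x) i = x i"
    by (fact nonsingular_on_inverse[OF E B, folded g_def])
  define m where "m = (\<lambda>i k. mat_vec E g' (\<lambda>j. h j k) i)"
  have mh: "mat_vec E m y i = mat_vec E g' (mat_vec E h y) i" for y i
    unfolding m_def by (rule mat_vec_mult)
  have mg: "mat_vec E m (mat_vec E g x) i = mat_vec E g' x i" if "i \<in> E" for x i
    unfolding mh by (intro mat_vec_cong) (simp_all add: hg)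
  \<comment> \<open>Exchanging \<open>p\<close> and \<open>q\<close> in the rows of \<open>B\<close>
    only swaps the two products in each of those summands.\<close>
  have iso': "(\<Sum>i\<in>E. mat_vec E g x i * mat_vec E g' y i + mat_vec E g' x i * mat_vec E g y i) = 0"
    for x y
  proof -
    have "(\<Sum>i\<in>E. mat_vec E g x i * mat_vec E g' y i + mat_vec E g' x i * mat_vec E g y i)
      = (\<Sum>i\<in>E. mat_vec E p x i * mat_vec E q y i + mat_vec E q x i * mat_vec E p y i)"
      by (intro sum.cong) (auto simp: g_def g'_def mat_vec_choose_rows)
    then show ?thesis using iso by (simp add: isotropic_def)
  qed
  have sym: "m k l = m l k" if kl: "k \<in> E" "l \<in> E" for k l
  proof -
    let ?e = "\<lambda>k j. if j = k then 1 else 0 :: bit"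
    have 1: "mat_vec E m (?e k) i = m i k" "mat_vec E m (?e l) i = m i l" for i
      using kl by (simp_all add: mat_vec_unit[OF E])
    \<comment> \<open>On the columns \<open>k\<close> and \<open>l\<close> of \<open>h\<close>,
      \<open>g\<close> gives unit vectors and \<open>g'\<close> gives the columns \<open>k\<close>
      and \<open>l\<close> of \<open>m\<close>, so the form collapses to
      \<open>m k l + m l k\<close>.\<close>
    have "0 = (\<Sum>i\<in>E. ?e k i * m i l + m i k * ?e l i)"
      using iso'[of "mat_vec E h (?e k)" "mat_vec E h (?e l)"]
      by (simp add: gh mh[symmetric] 1 cong: sum.cong)
    also have "\<dots> = (\<Sum>i\<in>E. if i = k then m i l else 0) + (\<Sum>i\<in>E. if i = l then m i k else 0)"
      unfolding sum.distrib[symmetric] by (intro sum.cong) auto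
    also have "\<dots> = m k l + m l k" using kl E by simp
    finally show ?thesis by (metis bit_add_eq_0_iff)
  qed
  have "nonsingular_on (choose_rows p q X) E \<longleftrightarrow> nonsingular_on m (E \<inter> sym_diff X B)" for X
    by (rule nonsingular_on_pivot[OF E B]) (rule mg[unfolded g_def g'_def])
  then show ?thesis using that[of m] sym by blast
qed

text \<open>The vectors annihilated by all rows other than \<open>a\<close> and \<open>b\<close> form a plane with basis
  \<open>k1\<close>, \<open>k2\<close> as soon as some choice of these two rows gives a non-singular matrix.  Every other
  choice is then decided by a 2 by 2 determinant.\<close>

lemma nonsingular_on_two_rows:
  fixes g :: "'a \<Rightarrow> 'a \<Rightarrow> bit"
  assumes E: "finite E" and ab: "a \<in> E" "b \<in> E" "a \<noteq> b"
    and ns: "nonsingular_on (g(a := r\<^sub>0, b := s\<^sub>0)) E"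
  obtains k1 k2 where "\<And>i. i \<in> E - {a, b} \<Longrightarrow> mat_vec E g k1 i = 0"
    and "\<And>i. i \<in> E - {a, b} \<Longrightarrow> mat_vec E g k2 i = 0"
    and "\<And>r s. nonsingular_on (g(a := r, b := s)) E \<longleftrightarrow>
      (\<Sum>j\<in>E. r j * k1 j) * (\<Sum>j\<in>E. s j * k2 j) + (\<Sum>j\<in>E. r j * k2 j) * (\<Sum>j\<in>E. s j * k1 j) = 1"
proof -
  define L where "L r x = (\<Sum>j\<in>E. r j * x j)" for r x :: "'a \<Rightarrow> bit"
  let ?G = "\<lambda>r s. g(a := r, b := s)"
  have rows: "mat_vec E (?G r s) x i = (if i = b then L s x else if i = a then L r x else mat_vec E g x i)"
    for r s x i
    by (auto simp: mat_vec_def L_def)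
  have L_lin: "L r (\<lambda>j. c * x j + d * y j) = c * L r x + d * L r y" for r x y c d
    by (simp add: L_def sum_distrib_left sum.distrib algebra_simps)
  have L_cong: "L r x = L r y" if "\<And>i. i \<in> E \<Longrightarrow> x i = y i" for r x y
    unfolding L_def using that by simp
  \<comment> \<open>The basis is chosen dual to the reference rows: \<open>r\<^sub>0\<close> and
    \<open>s\<^sub>0\<close> read off the coefficients of \<open>k1\<close> and
    \<open>k2\<close>.\<close>
  obtain k1 where k1: "\<And>i. i \<in> E \<Longrightarrow> mat_vec E (?G r\<^sub>0 s\<^sub>0) k1 i = (if i = a then 1 else 0)"
    using nonsingular_on_surj[OF E ns, of "\<lambda>i. if i = a then 1 else 0"] by blast
  obtain k2 where k2: "\<And>i. i \<in> E \<Longrightarrow> mat_vec E (?G r\<^sub>0 s\<^sub>0) k2 i = (if i = b then 1 else 0)"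
    using nonsingular_on_surj[OF E ns, of "\<lambda>i. if i = b then 1 else 0"] by blast
  have dual: "L r\<^sub>0 k1 = 1" "L s\<^sub>0 k1 = 0" "L r\<^sub>0 k2 = 0" "L s\<^sub>0 k2 = 1"
    using k1[of a] k1[of b] k2[of a] k2[of b] ab by (simp_all add: rows)
  have K: "mat_vec E g k1 i = 0" "mat_vec E g k2 i = 0" if "i \<in> E - {a, b}" for i
    using k1[of i] k2[of i] that by (simp_all add: rows)
  have comb: "mat_vec E g (\<lambda>j. c * k1 j + d * k2 j) i = 0" if "i \<in> E - {a, b}" for c d i
    using K[OF that] by (simp add: mat_vec_add mat_vec_scale)
  \<comment> \<open>The difference of both sides is annihilated by all rows other than
    \<open>a\<close> and \<open>b\<close>, and by duality also by \<open>r\<^sub>0\<close> and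
    \<open>s\<^sub>0\<close>, so it vanishes.\<close>
  have span: "x i = L r\<^sub>0 x * k1 i + L s\<^sub>0 x * k2 i"
    if x: "\<And>i. i \<in> E - {a, b} \<Longrightarrow> mat_vec E g x i = 0" and i: "i \<in> E" for x i
  proof -
    let ?y = "\<lambda>j. x j + (L r\<^sub>0 x * k1 j + L s\<^sub>0 x * k2 j)"
    have Ly: "L r ?y = L r x + (L r\<^sub>0 x * L r k1 + L s\<^sub>0 x * L r k2)" for r
      using L_lin[of r 1 x 1 "\<lambda>j. L r\<^sub>0 x * k1 j + L s\<^sub>0 x * k2 j"] by (simp add: L_lin)
    have "mat_vec E (?G r\<^sub>0 s\<^sub>0) ?y j = 0" if "j \<in> E" for j
      using that x[of j] comb[of j] dual unfolding rows Ly by (simp add: mat_vec_add[of E g x])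
    then have "?y i = 0" using ns i unfolding nonsingular_on_def by blast
    then show ?thesis by (simp add: bit_add_eq_0_iff)
  qed
  have iff: "nonsingular_on (?G r s) E \<longleftrightarrow>
      (\<forall>c d. c * L r k1 + d * L r k2 = 0 \<longrightarrow> c * L s k1 + d * L s k2 = 0 \<longrightarrow> c = 0 \<and> d = 0)"
    for r s
  proof
    assume G: "nonsingular_on (?G r s) E"
    show "\<forall>c d. c * L r k1 + d * L r k2 = 0 \<longrightarrow> c * L s k1 + d * L s k2 = 0 \<longrightarrow> c = 0 \<and> d = 0"
    proof (intro allI impI)
      fix c d assume 0: "c * L r k1 + d * L r k2 = 0" "c * L s k1 + d * L s k2 = 0"
      let ?x = "\<lambda>j. c * k1 j + d * k2 j"
      have "\<forall>i\<in>E. mat_vec E (?G r s) ?x i = 0"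
        using 0 comb by (simp add: rows L_lin)
      then have x: "?x i = 0" if "i \<in> E" for i
        using G that unfolding nonsingular_on_def by blast
      have "L r' ?x = 0" for r'
        unfolding L_def using x by (intro sum.neutral) simp
      from this[of "r\<^sub>0"] this[of "s\<^sub>0"] show "c = 0 \<and> d = 0"
        unfolding L_lin dual by simp
    qed
  next
    assume R: "\<forall>c d. c * L r k1 + d * L r k2 = 0 \<longrightarrow> c * L s k1 + d * L s k2 = 0 \<longrightarrow> c = 0 \<and> d = 0"
    show "nonsingular_on (?G r s) E"
      unfolding nonsingular_on_def
    proof (intro allI impI ballI)
      fix x i assume x: "\<forall>i\<in>E. mat_vec E (?G r s) x i = 0" and i: "i \<in> E"
      have K: "mat_vec E g x j = 0" if "j \<in> E - {a, b}" for j
        using bspec[OF x, of j] that by (simp add: rows)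
      have sp: "x l = L r\<^sub>0 x * k1 l + L s\<^sub>0 x * k2 l" if "l \<in> E" for l
        using span[OF K that] .
      have "L r' x = L r\<^sub>0 x * L r' k1 + L s\<^sub>0 x * L r' k2" for r'
        using L_cong[OF sp, where r = r'] by (simp add: L_lin)
      moreover have "L r x = 0" "L s x = 0"
        using x ab by (auto simp: rows split: if_splits)
      ultimately have "L r\<^sub>0 x = 0 \<and> L s\<^sub>0 x = 0"
        using R by metis
      then show "x i = 0" using sp[OF i] by simp
    qed
  qed
  \<comment> \<open>A 2 by 2 matrix over GF(2) has trivial kernel exactly when its determinant is 1;
    all values of the bits are enumerated.\<close>
  have bits: "(\<forall>c d. c * u + d * v = 0 \<longrightarrow> c * w + d * z = 0 \<longrightarrow> c = 0 \<and> d = 0)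
      \<longleftrightarrow> u * z + v * w = 1" for u v w z :: bit
  proof -
    have all: "(\<forall>c. P c) \<longleftrightarrow> P 0 \<and> P 1" for P :: "bit \<Rightarrow> bool"
      by (metis bit.exhaust)
    show ?thesis
      unfolding all by (cases u; cases v; cases w; cases z) simp_all
  qed
  have "nonsingular_on (?G r s) E \<longleftrightarrow> L r k1 * L s k2 + L r k2 * L s k1 = 1" for r s
    unfolding iff bits ..
  then show ?thesis
    using that[of k1 k2] K unfolding L_def by blast
qed

section \<open>Handle slides as symplectic row operations\<close>

text \<open>Used as \<open>slide_rows a b\<close> on \<open>q\<close> and with the indices reversed
  on \<open>p\<close>; the reversal is the inverse transpose operation that keeps the form
  invariant.\<close>

definition slide_rows :: "'a \<Rightarrow> 'a \<Rightarrow> ('a \<Rightarrow> 'a \<Rightarrow> bit) \<Rightarrow> 'a \<Rightarrow> 'a \<Rightarrow> bit" where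
  "slide_rows a b q = q(a := \<lambda>j. q a j + q b j)"

lemma mat_vec_slide_rows:
  "mat_vec E (slide_rows a b q) x i = mat_vec E q x i + (if i = a then mat_vec E q x b else 0)"
  by (simp add: mat_vec_def slide_rows_def distrib_right sum.distrib)

text \<open>Only the summands at \<open>a\<close> and \<open>b\<close> change, and both change by
  the same amount \<open>?d\<close>, so the changes cancel in characteristic 2.\<close>

lemma isotropic_slide:
  assumes E: "finite E" and ab: "a \<in> E" "b \<in> E" "a \<noteq> b" and iso: "isotropic E p q"
  shows "isotropic E (slide_rows b a p) (slide_rows a b q)"
  unfolding isotropic_def
proof (intro allI)
  fix x y
  let ?p = "mat_vec E p" and ?q = "mat_vec E q"
  let ?p' = "mat_vec E (slide_rows b a p)" and ?q' = "mat_vec E (slide_rows a b q)"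
  let ?d = "?p x a * ?q y b + ?q x b * ?p y a"
  have "(\<Sum>i\<in>E. ?p' x i * ?q' y i + ?q' x i * ?p' y i)
    = (\<Sum>i\<in>E. (?p x i * ?q y i + ?q x i * ?p y i) + ((if i = b then ?d else 0) + (if i = a then ?d else 0)))"
    using \<open>a \<noteq> b\<close> by (intro sum.cong) (auto simp: mat_vec_slide_rows algebra_simps)
  also have "\<dots> = (\<Sum>i\<in>E. ?p x i * ?q y i + ?q x i * ?p y i) + (?d + ?d)"
    using E ab unfolding sum.distrib by simp
  also have "\<dots> = 0"
    using iso unfolding isotropic_def bit_add_self by simp
  finally show "(\<Sum>i\<in>E. ?p' x i * ?q' y i + ?q' x i * ?p' y i) = 0" .
qed

lemma nonsingular_on_slide:
  assumes E: "finite E" and ab: "a \<in> E" "b \<in> E" "a \<noteq> b" and iso: "isotropic E p q"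
  shows "nonsingular_on (choose_rows (slide_rows b a p) (slide_rows a b q) X) E \<longleftrightarrow>
    (if a \<in> X \<and> b \<notin> X
     then nonsingular_on (choose_rows p q X) E \<noteq> nonsingular_on (choose_rows p q (insert b (X - {a}))) E
     else nonsingular_on (choose_rows p q X) E)"
proof (cases "a \<in> X \<and> b \<notin> X")
  case False
  \<comment> \<open>With \<open>a\<close> and \<open>b\<close> both inside or both outside
    \<open>X\<close> the change is an elementary row operation; with only \<open>b\<close> inside,
    the chosen rows are unchanged. The kernel is the same in each case.\<close>
  have "(\<forall>i\<in>E. mat_vec E (choose_rows (slide_rows b a p) (slide_rows a b q) X) x i = 0) \<longleftrightarrow>
      (\<forall>i\<in>E. mat_vec E (choose_rows p q X) x i = 0)" (is "(\<forall>i\<in>E. ?A i = 0) \<longleftrightarrow> (\<forall>i\<in>E. ?B i = 0)") for x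
  proof -
    have "?A i = ?B i" if "i \<noteq> a" "i \<noteq> b" for i
      using that by (simp add: mat_vec_choose_rows mat_vec_slide_rows)
    moreover have "?A a = 0 \<and> ?A b = 0 \<longleftrightarrow> ?B a = 0 \<and> ?B b = 0"
      using False \<open>a \<noteq> b\<close> by (auto simp: mat_vec_choose_rows mat_vec_slide_rows)
    ultimately show ?thesis using ab by metis
  qed
  then show ?thesis unfolding nonsingular_on_def if_not_P[OF False] by simp
next
  case True
  let ?g = "choose_rows p q X"
  \<comment> \<open>All three matrices are written as updates of \<open>?g\<close> in rows
    \<open>a\<close> and \<open>b\<close>, so that one basis \<open>k1\<close>, \<open>k2\<close>
    decides them all.\<close>
  have g: "?g = ?g(a := q a, b := p b)"
    using True by (auto simp: choose_rows_def fun_eq_iff)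
  have g1: "choose_rows p q (insert b (X - {a})) = ?g(a := p a, b := q b)"
    using ab by (auto simp: choose_rows_def fun_eq_iff)
  have g2: "choose_rows (slide_rows b a p) (slide_rows a b q) X
      = ?g(a := \<lambda>j. q a j + q b j, b := \<lambda>j. p b j + p a j)"
    using True by (auto simp: choose_rows_def slide_rows_def fun_eq_iff)
  show ?thesis
  proof (cases "\<exists>r s. nonsingular_on (?g(a := r, b := s)) E")
    \<comment> \<open>All three matrices are singular, and the exclusive or of two false statements
      is false.\<close>
    case False
    then show ?thesis using True g g1 g2 by metis
  next
    case ex: True
    then obtain r\<^sub>0 s\<^sub>0 where "nonsingular_on (?g(a := r\<^sub>0, b := s\<^sub>0)) E" by blast
    from nonsingular_on_two_rows[OF E ab this] obtain k1 k2
      where K: "\<And>i. i \<in> E - {a, b} \<Longrightarrow> mat_vec E ?g k1 i = 0"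
        "\<And>i. i \<in> E - {a, b} \<Longrightarrow> mat_vec E ?g k2 i = 0"
      and det: "\<And>r s. nonsingular_on (?g(a := r, b := s)) E \<longleftrightarrow>
        (\<Sum>j\<in>E. r j * k1 j) * (\<Sum>j\<in>E. s j * k2 j) + (\<Sum>j\<in>E. r j * k2 j) * (\<Sum>j\<in>E. s j * k1 j) = 1"
      by blast
    let ?p = "mat_vec E p" and ?q = "mat_vec E q"
    let ?w = "\<lambda>i. ?p k1 i * ?q k2 i + ?q k1 i * ?p k2 i"
    \<comment> \<open>At every other index \<open>k1\<close> and \<open>k2\<close> are both
      annihilated by the same chosen row, from \<open>p\<close> or from \<open>q\<close>, and each
      product contains such a factor. Isotropy therefore reduces to the indices \<open>a\<close> and
      \<open>b\<close>.\<close>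
    have w: "?w i = 0" if "i \<in> E - {a, b}" for i
      using K[OF that] by (auto simp: mat_vec_choose_rows split: if_splits)
    have "0 = sum ?w E" using iso by (simp add: isotropic_def)
    also have "\<dots> = sum ?w {a, b}"
      using E ab w by (intro sum.mono_neutral_right) auto
    also have "\<dots> = ?w a + ?w b" using \<open>a \<noteq> b\<close> by simp
    finally have w0: "?w a + ?w b = 0" by simp
    have "nonsingular_on ?g E \<longleftrightarrow> ?q k1 a * ?p k2 b + ?q k2 a * ?p k1 b = 1"
      by (subst g) (simp only: det mat_vec_def)
    moreover have "nonsingular_on (choose_rows p q (insert b (X - {a}))) E
        \<longleftrightarrow> ?p k1 a * ?q k2 b + ?p k2 a * ?q k1 b = 1"
      unfolding g1 by (simp only: det mat_vec_def)
    moreover have "nonsingular_on (choose_rows (slide_rows b a p) (slide_rows a b q) X) E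
        \<longleftrightarrow> (?q k1 a + ?q k1 b) * (?p k2 b + ?p k2 a) + (?q k2 a + ?q k2 b) * (?p k1 b + ?p k1 a) = 1"
      unfolding g2 by (simp only: det mat_vec_def distrib_right sum.distrib)
    \<comment> \<open>Bilinear expansion of the new determinant: the terms mixing \<open>a\<close>
      and \<open>b\<close> form the two old determinants, the others form
      \<open>?w a + ?w b\<close>, which is zero.\<close>
    moreover have "(?q k1 a + ?q k1 b) * (?p k2 b + ?p k2 a) + (?q k2 a + ?q k2 b) * (?p k1 b + ?p k1 a)
      = (?q k1 a * ?p k2 b + ?q k2 a * ?p k1 b) + (?p k1 a * ?q k2 b + ?p k2 a * ?q k1 b) + (?w a + ?w b)"
      by (simp add: algebra_simps)
    moreover have "u + v = 1 \<longleftrightarrow> (u = 1) \<noteq> (v = 1)" for u v :: bit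
      by (cases u; cases v) simp_all
    ultimately show ?thesis using True w0 by simp
  qed
qed

section \<open>Isotropic pairs and binary delta-matroids\<close>

text \<open>After rebasing at \<open>X\<close>, feasibility of \<open>sym_diff X Z\<close> for
  \<open>Z \<subseteq> E\<close> is non-singularity of the principal submatrix of \<open>m\<close>
  on \<open>Z\<close>. The exchange axiom then asks for a non-singular principal submatrix on some
  \<open>{u, v}\<close> inside the non-singular one on \<open>sym_diff X Y\<close>.\<close>

lemma delta_matroid_of_isotropic:
  assumes E: "finite E" and F: "F \<subseteq> Pow E" "F \<noteq> {}" and iso: "isotropic E p q"
    and rep: "\<And>X. X \<subseteq> E \<Longrightarrow> X \<in> F \<longleftrightarrow> nonsingular_on (choose_rows p q X) E"
  shows "delta_matroid (E, F)"
proof -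
  have "\<exists>v\<in>sym_diff X Y. sym_diff X {u, v} \<in> F" if X: "X \<in> F" and Y: "Y \<in> F" and u: "u \<in> sym_diff X Y" for X Y u
  proof -
    have XE: "X \<subseteq> E" and YE: "Y \<subseteq> E" using F(1) X Y by auto
    obtain m :: "'a \<Rightarrow> 'a \<Rightarrow> bit" where sym: "\<And>i j. i \<in> E \<Longrightarrow> j \<in> E \<Longrightarrow> m i j = m j i"
      and m: "\<And>Z. nonsingular_on (choose_rows p q Z) E \<longleftrightarrow> nonsingular_on m (E \<inter> sym_diff Z X)"
      by (fact isotropic_rebase[OF E iso rep[OF XE, THEN iffD1, OF X]])
    let ?S = "sym_diff X Y"
    have S: "?S \<subseteq> E" "finite ?S" using XE YE finite_subset[OF _ E] by auto
    have eq: "E \<inter> sym_diff Y X = ?S" using XE YE by blast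
    have ns: "nonsingular_on m ?S" using rep[OF YE] Y m[of Y] unfolding eq by simp
    have row: "mat_vec ?S m (\<lambda>j. if j = u then 1 else 0) i = m i u" for i
      using S u by (intro mat_vec_unit) auto
    \<comment> \<open>If column \<open>u\<close> were zero on \<open>?S\<close>, the unit vector at
      \<open>u\<close> would lie in the kernel.\<close>
    have "\<exists>v\<in>?S. m v u \<noteq> 0"
    proof (rule ccontr)
      assume "\<not> ?thesis"
      then have "\<forall>i\<in>?S. mat_vec ?S m (\<lambda>j. if j = u then 1 else 0) i = 0" by (simp add: row)
      then have "\<forall>i\<in>?S. (if i = u then 1 else 0 :: bit) = 0"
        using ns unfolding nonsingular_on_def by blast
      from bspec[OF this u] show False by simp
    qed
    \<comment> \<open>Taking \<open>v = u\<close> whenever the diagonal entry is 1 ensures that for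
      \<open>v \<noteq> u\<close> the block has \<open>m u u = 0\<close> and off-diagonal entries 1,
      hence determinant 1.\<close>
    then obtain v where v: "v \<in> ?S" "m v u = 1" and v': "m u u = 1 \<Longrightarrow> v = u"
      using u by (metis bit_not_zero_iff)
    have "nonsingular_on m {u, v}"
    proof (cases "v = u")
      case True
      then show ?thesis using v by (simp add: nonsingular_on_def mat_vec_def)
    next
      case False
      then have "m u u = 0" using v' bit_not_one_iff by blast
      moreover have "m u v = 1" using v sym[of u v] u S(1) by auto
      ultimately show ?thesis using False v(2) by (auto simp: nonsingular_on_def mat_vec_def)
    qed
    moreover have "E \<inter> sym_diff (sym_diff X {u, v}) X = {u, v}" using u v(1) XE YE by blast
    ultimately have "nonsingular_on (choose_rows p q (sym_diff X {u, v})) E" unfolding m by simp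
    moreover have "sym_diff X {u, v} \<subseteq> E" using u v(1) XE YE by blast
    ultimately show ?thesis using rep v(1) by blast
  qed
  then show ?thesis using assms unfolding delta_matroid_def by simp
qed

text \<open>Any feasible \<open>B\<close> can serve as the twisting set: rebasing at
  \<open>B\<close> gives a symmetric matrix on \<open>E\<close>, and an enumeration of
  \<open>E\<close> turns it into \<open>M\<close>.\<close>

lemma binary_of_isotropic:
  assumes E: "finite E" and F: "F \<subseteq> Pow E" "F \<noteq> {}" and iso: "isotropic E p q"
    and rep: "\<And>X. X \<subseteq> E \<Longrightarrow> X \<in> F \<longleftrightarrow> nonsingular_on (choose_rows p q X) E"
  shows "binary_delta_matroid (E, F)"
proof -
  obtain B where B: "B \<in> F" "B \<subseteq> E" using F by blast
  obtain m :: "'a \<Rightarrow> 'a \<Rightarrow> bit" where sym: "\<And>i j. i \<in> E \<Longrightarrow> j \<in> E \<Longrightarrow> m i j = m j i"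
    and m: "\<And>Z. nonsingular_on (choose_rows p q Z) E \<longleftrightarrow> nonsingular_on m (E \<inter> sym_diff Z B)"
    by (fact isotropic_rebase[OF E iso rep[OF B(2), THEN iffD1, OF B(1)]])
  define n where "n = card E"
  obtain f where f: "bij_betw f E {0..<n}" unfolding n_def using ex_bij_betw_finite_nat[OF E] by blast
  define M where "M = mat n n (\<lambda>(i, j). m (inv_into E f i) (inv_into E f j))"
  have M: "M \<in> carrier_mat n n" by (simp add: M_def)
  have "inv_into E f i \<in> E" if "i < n" for i
    using f that by (metis atLeastLessThan_iff bij_betw_def inv_into_into zero_le)
  then have "transpose_mat M = M"
    by (intro eq_matI) (auto simp: M_def intro: sym)
  moreover have "isomorphic (twist (E, F) B) (matrix_system M)"
    unfolding isomorphic_def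
  proof (intro exI conjI allI impI)
    show "bij_betw f (fst (twist (E, F) B)) (fst (matrix_system M))"
      using f M by (simp add: twist_def matrix_system_def)
    fix Y assume "Y \<subseteq> fst (twist (E, F) B)"
    then have Y: "Y \<subseteq> E" by (simp add: twist_def)
    then have fY: "f ` Y \<subseteq> {0..<n}" using f by (auto simp: bij_betw_def)
    have inj: "inj_on f Y" using f Y by (meson bij_betw_def inj_on_subset)
    have "nonsingular_on (\<lambda>i j. M $$ (i, j)) (f ` Y) \<longleftrightarrow> nonsingular_on m Y"
    proof (rule nonsingular_on_image[OF inj])
      fix i j assume ij: "i \<in> Y" "j \<in> Y"
      then have "f i < n" "f j < n" using fY by auto
      then show "M $$ (f i, f j) = m i j"
        using ij Y f by (simp add: M_def bij_betw_def inv_into_f_f subset_iff)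
    qed
    then have "f ` Y \<in> snd (matrix_system M) \<longleftrightarrow> nonsingular_on m Y"
      using M fY det_submatrix_neq_0_iff[OF M fY] by (simp add: matrix_system_def)
    moreover have "Y \<in> snd (twist (E, F) B) \<longleftrightarrow> sym_diff B Y \<in> F"
    proof
      assume "Y \<in> snd (twist (E, F) B)"
      then obtain X where X: "X \<in> F" "Y = sym_diff B X" by (auto simp: twist_def)
      then have "sym_diff B Y = X" by blast
      then show "sym_diff B Y \<in> F" using X by simp
    next
      assume *: "sym_diff B Y \<in> F"
      have "Y = sym_diff B (sym_diff B Y)" by blast
      with * show "Y \<in> snd (twist (E, F) B)" unfolding twist_def by auto
    qed
    moreover have "sym_diff B Y \<subseteq> E" using B Y by blast
    moreover have "E \<inter> sym_diff (sym_diff B Y) B = Y" using Y by blast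
    ultimately show "Y \<in> snd (twist (E, F) B) \<longleftrightarrow> f ` Y \<in> snd (matrix_system M)"
      using rep m by simp
  qed
  ultimately show ?thesis
    unfolding binary_delta_matroid_def
    using delta_matroid_of_isotropic[OF assms] B(2) M by auto
qed

text \<open>The pair is the identity and the relabelled matrix \<open>m\<close> with the rows in
  \<open>A\<close> exchanged. The choice \<open>A\<close> then gives the identity matrix, so
  pivoting there recovers the principal submatrices of \<open>m\<close>.\<close>

lemma isotropic_of_binary:
  assumes bin: "binary_delta_matroid (E, F)"
  obtains p q where "isotropic E p q"
    and "\<And>X. X \<subseteq> E \<Longrightarrow> X \<in> F \<longleftrightarrow> nonsingular_on (choose_rows p q X) E"
proof -
  obtain A n and M :: "bit mat" where A: "A \<subseteq> E" and M: "M \<in> carrier_mat n n" "transpose_mat M = M"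
    and "isomorphic (twist (E, F) A) (matrix_system M)" and E: "finite E"
    using bin unfolding binary_delta_matroid_def delta_matroid_def by auto
  then obtain f where f: "bij_betw f E {0..<n}"
    and iso: "\<And>Y. Y \<subseteq> E \<Longrightarrow> Y \<in> snd (twist (E, F) A) \<longleftrightarrow> f ` Y \<in> snd (matrix_system M)"
    unfolding isomorphic_def by (auto simp: twist_def matrix_system_def)
  define m where "m i j = M $$ (f i, f j)" for i j
  define e :: "'a \<Rightarrow> 'a \<Rightarrow> bit" where "e i j = (if i = j then 1 else 0)" for i j
  define p where "p = choose_rows e m A"
  define q where "q = choose_rows m e A"
  have e: "mat_vec E e x i = x i" if "i \<in> E" for x i
    using that E by (simp add: mat_vec_def e_def if_distrib[of "\<lambda>c. c * _"] cong: if_cong)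
  have fE: "f i < n" if "i \<in> E" for i using f that by (auto simp: bij_betw_def)
  have sym: "m i j = m j i" if "i \<in> E" "j \<in> E" for i j
    using M fE[OF that(1)] fE[OF that(2)] unfolding m_def by (metis carrier_matD index_transpose_mat(1))
  have isotr: "isotropic E p q"
    unfolding isotropic_def
  proof (intro allI)
    fix x y
    have "(\<Sum>i\<in>E. mat_vec E p x i * mat_vec E q y i + mat_vec E q x i * mat_vec E p y i)
      = (\<Sum>i\<in>E. x i * mat_vec E m y i + mat_vec E m x i * y i)"
      by (intro sum.cong) (auto simp: p_def q_def mat_vec_choose_rows e add.commute)
    also have "\<dots> = (\<Sum>i\<in>E. \<Sum>j\<in>E. x i * m i j * y j) + (\<Sum>i\<in>E. \<Sum>j\<in>E. m i j * x j * y i)"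
      by (simp add: mat_vec_def sum.distrib sum_distrib_left sum_distrib_right mult.assoc)
    also have "(\<Sum>i\<in>E. \<Sum>j\<in>E. m i j * x j * y i) = (\<Sum>j\<in>E. \<Sum>i\<in>E. m i j * x j * y i)"
      by (rule sum.swap)
    \<comment> \<open>Symmetry of \<open>m\<close> makes the two double sums equal, so they cancel
      over GF(2).\<close>
    also have "\<dots> = (\<Sum>i\<in>E. \<Sum>j\<in>E. x i * m i j * y j)"
      using sym by (intro sum.cong) (auto simp: ac_simps)
    finally show "(\<Sum>i\<in>E. mat_vec E p x i * mat_vec E q y i + mat_vec E q x i * mat_vec E p y i) = 0"
      by simp
  qed
  have pq: "choose_rows p q A = e" "choose_rows q p A = m"
    by (auto simp: choose_rows_def p_def q_def fun_eq_iff)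
  have "nonsingular_on (choose_rows p q X) E \<longleftrightarrow> nonsingular_on m (E \<inter> sym_diff X A)" for X
  proof (rule nonsingular_on_pivot[OF E], unfold pq)
    show "nonsingular_on e E" by (simp add: nonsingular_on_def e)
    show "mat_vec E m (mat_vec E e x) i = mat_vec E m x i" for x i
      by (rule mat_vec_cong) (simp_all add: e)
  qed
  moreover have "E \<inter> sym_diff X A = sym_diff A X" if "X \<subseteq> E" for X
    using that A by blast
  ultimately have ns: "nonsingular_on (choose_rows p q X) E \<longleftrightarrow> nonsingular_on m (sym_diff A X)"
    if "X \<subseteq> E" for X
    using that by simp
  have "X \<in> F \<longleftrightarrow> nonsingular_on (choose_rows p q X) E" if X: "X \<subseteq> E" for X
  proof -
    let ?S = "sym_diff A X"
    have S: "?S \<subseteq> E" using A X by blast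
    have inj: "inj_on f ?S" using f S by (meson bij_betw_def inj_on_subset)
    have fS: "f ` ?S \<subseteq> {0..<n}" using fE S by auto
    have "X \<in> F \<longleftrightarrow> ?S \<in> snd (twist (E, F) A)"
    proof
      assume "?S \<in> snd (twist (E, F) A)"
      then obtain Z where Z: "Z \<in> F" "?S = sym_diff A Z" by (auto simp: twist_def)
      then have "X = Z" by blast
      with Z show "X \<in> F" by simp
    qed (auto simp: twist_def)
    also have "\<dots> \<longleftrightarrow> nonsingular_on (\<lambda>i j. M $$ (i, j)) (f ` ?S)"
      using iso[OF S] M fS det_submatrix_neq_0_iff[OF M(1) fS] by (simp add: matrix_system_def)
    also have "\<dots> \<longleftrightarrow> nonsingular_on m ?S"
      by (rule nonsingular_on_image[OF inj]) (simp add: m_def)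
    finally show ?thesis using ns[OF X] by simp
  qed
  with isotr show ?thesis using that by blast
qed

section \<open>The handle slide of a represented set system\<close>

lemma handle_slide_eq:
  "handle_slide (E, F) a b = (E, snd (handle_slide (E, F) a b))"
  by (simp add: handle_slide_def)

text \<open>A set \<open>Y \<union> {a}\<close> determines \<open>Y\<close>, so membership can be
  decided set by set. The case distinction has the shape of \<open>nonsingular_on_slide\<close>, and
  the two match term by term.\<close>

lemma mem_handle_slide_iff:
  assumes "X \<subseteq> E" "a \<noteq> b"
  shows "X \<in> snd (handle_slide (E, F) a b) \<longleftrightarrow>
    (if a \<in> X \<and> b \<notin> X then (X \<in> F) \<noteq> (insert b (X - {a}) \<in> F) else X \<in> F)"
proof -
  have "(\<exists>Y. X = Y \<union> {a} \<and> Y \<subseteq> E - {a, b} \<and> Y \<union> {b} \<in> F) \<longleftrightarrow>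
      a \<in> X \<and> b \<notin> X \<and> insert b (X - {a}) \<in> F" (is "?L \<longleftrightarrow> ?R")
  proof
    assume ?L
    then obtain Y where Y: "X = Y \<union> {a}" "Y \<subseteq> E - {a, b}" "Y \<union> {b} \<in> F" by blast
    then have "Y \<union> {b} = insert b (X - {a})" by blast
    with Y assms(2) show ?R by auto
  next
    assume R: ?R
    then have "X = (X - {a}) \<union> {a}" "X - {a} \<subseteq> E - {a, b}" "(X - {a}) \<union> {b} \<in> F"
      using assms by auto
    then show ?L by blast
  qed
  then show ?thesis by (auto simp: handle_slide_def)
qed

theorem theorem4p1:
  fixes E :: "'a set" and F :: "'a set set" and a b :: 'a
  assumes "binary_delta_matroid (E, F)"
    and "a \<in> E" and "b \<in> E" and "a \<noteq> b"
  shows "binary_delta_matroid (handle_slide (E, F) a b)"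
proof -
  have E: "finite E" and F: "F \<subseteq> Pow E" "F \<noteq> {}"
    using assms(1) by (auto simp: binary_delta_matroid_def delta_matroid_def)
  obtain p q where iso: "isotropic E p q"
    and rep: "\<And>X. X \<subseteq> E \<Longrightarrow> X \<in> F \<longleftrightarrow> nonsingular_on (choose_rows p q X) E"
    using isotropic_of_binary[OF assms(1)] by blast
  let ?F' = "snd (handle_slide (E, F) a b)"
  note mem = mem_handle_slide_iff[OF _ \<open>a \<noteq> b\<close>, of _ E F]
  have "?F' \<subseteq> Pow E" using F(1) \<open>a \<in> E\<close> by (auto simp: handle_slide_def)
  moreover have "?F' \<noteq> {}"
  proof -
    obtain X where X: "X \<in> F" "X \<subseteq> E" using F by blast
    let ?Y = "insert b (X - {a})"
    have "?Y \<subseteq> E" using X \<open>b \<in> E\<close> by blast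
    \<comment> \<open>If \<open>X\<close> is lost, then \<open>a \<in> X\<close>,
      \<open>b \<notin> X\<close> and \<open>?Y\<close> is feasible; since
      \<open>a \<notin> ?Y\<close>, the slide keeps \<open>?Y\<close>.\<close>
    then have "X \<in> ?F' \<or> ?Y \<in> ?F'" using X mem[of X] mem[of ?Y] \<open>a \<noteq> b\<close> by auto
    then show ?thesis by blast
  qed
  moreover have "X \<in> ?F' \<longleftrightarrow>
      nonsingular_on (choose_rows (slide_rows b a p) (slide_rows a b q) X) E" if X: "X \<subseteq> E" for X
  proof -
    have "insert b (X - {a}) \<subseteq> E" using X \<open>b \<in> E\<close> by blast
    then show ?thesis
      unfolding mem[OF X] nonsingular_on_slide[OF E assms(2-4) iso] using X by (simp add: rep)
  qed
  ultimately show ?thesis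
    using binary_of_isotropic[OF E _ _ isotropic_slide[OF E assms(2-4) iso]] handle_slide_eq by metis
qed

end
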